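(* Fix $\alpha > 0$, and let $\epsilon_1,\epsilon_2,\dots$ be independent random variables taking the values $\pm1$ each with probability $1/2$. Then \[Q_1\left(\sum_{i=1}^n \epsilon_i\, i^{\alpha} \right) = \Omega\left( n^{-(1/2 + \alpha)}\right)\quad\text{as } n\to\infty.\] Moreover, for any $\delta \geq 1/2$, there exist a sequence $(a_n)_{n \geq 1}$ of non-negative real step sizes and a sequence of times $(n_k)_{k \geq 1}$ with $n_k\to\infty$ such that \[n^{\alpha} \le a_n \le n^{\alpha+\delta}\] for all sufficiently large $n$, and, as $k \to \infty$, \[Q_1\left(\sum_{i=1}^{n_k}\epsilon_i a_i \right) \geq n_k^{-\left(\frac12 + \frac{\alpha}{2\delta} + o(1)\right)}.\]
   Context: For a real-valued random variable $A$ and $r>0$, the (Lévy) concentration function is $Q_r(A) = \sup_{x \in \mathbb{R}} \mathbb{P}(x < A \le x+r)$. *)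

theory Defs
  imports "HOL-Probability.Probability" "HOL-Library.Landau_Symbols"
begin

definition concentration_fun :: "real \<Rightarrow> 'a measure \<Rightarrow> ('a \<Rightarrow> real) \<Rightarrow> real" where
  "concentration_fun r M A = (SUP x::real. \<P>(\<omega> in M. x < A \<omega> \<and> A \<omega> \<le> x + r))"

text \<open>Indices start at 1; the value at index 0 is irrelevant.\<close>

definition rademacher_sequence :: "'a measure \<Rightarrow> (nat \<Rightarrow> 'a \<Rightarrow> real) \<Rightarrow> bool" where
  "rademacher_sequence M \<epsilon> \<longleftrightarrow>
     prob_space.indep_vars M (\<lambda>_. borel) \<epsilon> {1..} \<and>
     (\<forall>i\<ge>1. \<P>(\<omega> in M. \<epsilon> i \<omega> = 1) = 1 / 2 \<and> \<P>(\<omega> in M. \<epsilon> i \<omega> = -1) = 1 / 2)"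

end

theory Submission
  imports Defs "HOL-Real_Asymp.Real_Asymp"
begin

text \<open>
  Both halves rest on one observation: a random variable whose second moment is at most
  \<open>s\<^sup>2\<close> spends probability at least \<open>3/4\<close> in an interval of length
  \<open>4 s\<close>, so by pigeonhole some unit interval carries probability of order \<open>1 / s\<close>
  (lemma \<open>ex_unit_interval_prob_ge\<close>). The sum with steps \<open>i powr \<alpha>\<close> has second moment
  at most \<open>n powr (2 * \<alpha> + 1)\<close>, which is the first claim.

  For the second claim the same observation is used at a smaller scale. If all steps in a block
  equal one constant \<open>A\<close>, then the block contributes \<open>A\<close> times a sum of at most \<open>N\<close>
  signs; that sum is an integer, so a unit interval of probability of order \<open>1 / sqrt N\<close>
  yields an atom, and the size of \<open>A\<close> costs nothing. Sums over different blocks are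
  independent, so atoms of the blocks multiply to an atom of the whole sum
  (lemma \<open>block_constant_signed_sum_atom\<close>).

  It remains to choose the blocks. On the block that ends at \<open>t (k+1)\<close> the step is
  \<open>t (k+1) powr \<alpha>\<close>, which respects the lower bound throughout the block. At the first index
  of the block, just after \<open>t k\<close>, the upper bound reads
  \<open>t (k+1) powr \<alpha> \<le> (t k + 1) powr (\<alpha> + \<delta>)\<close>, so the blocks may grow as fast as
  \<open>t (k+1) \<approx> t k powr q\<close> with \<open>q = 1 + \<delta> / \<alpha>\<close>; taking \<open>t k\<close> to be the integer part
  of \<open>exp (q ^ k)\<close> achieves this. With \<open>n = t k\<close>, the product of the
  factors \<open>1 / sqrt (t j)\<close> over \<open>j \<le> k\<close> is about \<open>n\<close> to the power
  \<open>- (1 + 1/q + 1/q\<^sup>2 + ...) / 2 = - q / (2 * (q - 1)) = - (1/2 + \<alpha> / (2 * \<delta>))\<close>.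
  The constants lost, one for each block, form a factor exponential in \<open>k\<close>, and since
  \<open>ln n \<approx> q ^ k\<close> this only changes the exponent by \<open>o(1)\<close>.
\<close>

section \<open>Concentration from a second moment\<close>

lemma (in prob_space) concentration_fun_ge:
  "\<P>(\<omega> in M. x < A \<omega> \<and> A \<omega> \<le> x + r) \<le> concentration_fun r M A"
  unfolding concentration_fun_def
  by (intro cSUP_upper bdd_aboveI[where M = 1]) auto

lemma (in prob_space) atom_le_concentration_fun:
  assumes [measurable]: "random_variable borel X" and "0 < r"
  shows "\<P>(\<omega> in M. X \<omega> = v) \<le> concentration_fun r M X"
proof -
  have "\<P>(\<omega> in M. X \<omega> = v) \<le> \<P>(\<omega> in M. v - r < X \<omega> \<and> X \<omega> \<le> v - r + r)"
    using \<open>0 < r\<close> by (intro finite_measure_mono) auto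
  also have "\<dots> \<le> concentration_fun r M X"
    by (rule concentration_fun_ge)
  finally show ?thesis .
qed

text \<open>
  By the second moment method, \<open>X\<close> lies in \<open>(-2s, 2s)\<close> with probability at least
  \<open>3/4\<close>; since \<open>s \<ge> 1\<close>, at most \<open>4s + 1 \<le> 5s\<close> unit intervals cover that range, and
  one of them receives at least its share \<open>(3/4) / (5s)\<close>.
\<close>

lemma (in prob_space) ex_unit_interval_prob_ge:
  fixes X :: "'a \<Rightarrow> real"
  assumes [measurable]: "random_variable borel X"
    and "integrable M (\<lambda>\<omega>. (X \<omega>)\<^sup>2)"
    and "expectation (\<lambda>\<omega>. (X \<omega>)\<^sup>2) \<le> s\<^sup>2" and s: "s \<ge> 1"
  shows "\<exists>x. 3 / (20 * s) \<le> \<P>(\<omega> in M. x < X \<omega> \<and> X \<omega> \<le> x + 1)"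
proof (rule ccontr)
  assume no: "\<not> ?thesis"
  define I where "I j = {\<omega> \<in> space M. - 2 * s + real j < X \<omega> \<and> X \<omega> \<le> - 2 * s + real j + 1}" for j
  define N where "N = nat \<lceil>4 * s\<rceil>"
  have N: "real N \<le> 5 * s" "N > 0"
    using s unfolding N_def by linarith+
  have "prob {\<omega> \<in> space M. 2 * s \<le> \<bar>X \<omega>\<bar>} \<le> expectation (\<lambda>\<omega>. (X \<omega>)\<^sup>2) / (2 * s)\<^sup>2"
    using assms by (intro second_moment_method) auto
  also have "\<dots> \<le> s\<^sup>2 / (2 * s)\<^sup>2"
    by (intro divide_right_mono assms) auto
  also have "\<dots> = 1 / 4"
    using s by (simp add: power2_eq_square)
  finally have "3 / 4 \<le> 1 - prob {\<omega> \<in> space M. 2 * s \<le> \<bar>X \<omega>\<bar>}"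
    by simp
  also have "\<dots> = prob (space M - {\<omega> \<in> space M. 2 * s \<le> \<bar>X \<omega>\<bar>})"
    by (intro prob_compl[symmetric]) auto
  also have "\<dots> \<le> prob (\<Union>j<N. I j)"
  proof (intro finite_measure_mono)
    show "space M - {\<omega> \<in> space M. 2 * s \<le> \<bar>X \<omega>\<bar>} \<subseteq> (\<Union>j<N. I j)"
    proof
      fix \<omega> assume "\<omega> \<in> space M - {\<omega> \<in> space M. 2 * s \<le> \<bar>X \<omega>\<bar>}"
      then have \<omega>: "\<omega> \<in> space M" "\<bar>X \<omega>\<bar> < 2 * s" by auto
      define j where "j = nat (\<lceil>X \<omega> + 2 * s\<rceil> - 1)"
      have "\<omega> \<in> I j" "j < N"
        using \<omega> s unfolding I_def j_def N_def by (auto, linarith+)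
      then show "\<omega> \<in> (\<Union>j<N. I j)" by auto
    qed
    show "(\<Union>j<N. I j) \<in> events"
      unfolding I_def by measurable
  qed
  also have "\<dots> \<le> (\<Sum>j<N. prob (I j))"
    by (intro finite_measure_subadditive_finite) (auto simp: I_def)
  also have "\<dots> < (\<Sum>j<N. 3 / (20 * s))"
    using no N(2) unfolding I_def by (intro sum_strict_mono) (auto simp: not_le)
  also have "\<dots> \<le> 3 / 4"
    using N s by (simp add: field_simps)
  finally show False by simp
qed

section \<open>Weighted sums of random signs\<close>

locale rademacher_space = prob_space M for M :: "'a measure" +
  fixes \<epsilon> :: "nat \<Rightarrow> 'a \<Rightarrow> real"
  assumes rademacher: "rademacher_sequence M \<epsilon>"
begin

lemma indep_signs: "indep_vars (\<lambda>_. borel) \<epsilon> {1..}"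
  using rademacher by (simp add: rademacher_sequence_def)

lemma measurable_sign: "1 \<le> i \<Longrightarrow> \<epsilon> i \<in> borel_measurable M"
  using indep_signs by (auto simp: indep_vars_def)

lemma prob_sign:
  assumes "1 \<le> i"
  shows "\<P>(\<omega> in M. \<epsilon> i \<omega> = 1) = 1 / 2" "\<P>(\<omega> in M. \<epsilon> i \<omega> = -1) = 1 / 2"
  using rademacher assms by (auto simp: rademacher_sequence_def)

lemma AE_sign:
  assumes "1 \<le> i"
  shows "AE \<omega> in M. \<epsilon> i \<omega> = 1 \<or> \<epsilon> i \<omega> = -1"
proof -
  note [measurable] = measurable_sign[OF assms]
  have "\<P>(\<omega> in M. \<epsilon> i \<omega> = 1 \<or> \<epsilon> i \<omega> = -1) =
      prob ({\<omega> \<in> space M. \<epsilon> i \<omega> = 1} \<union> {\<omega> \<in> space M. \<epsilon> i \<omega> = -1})"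
    by (intro arg_cong[where f = prob]) auto
  also have "\<dots> = \<P>(\<omega> in M. \<epsilon> i \<omega> = 1) + \<P>(\<omega> in M. \<epsilon> i \<omega> = -1)"
    by (intro finite_measure_Union) auto
  finally have "\<P>(\<omega> in M. \<epsilon> i \<omega> = 1 \<or> \<epsilon> i \<omega> = -1) = 1"
    using prob_sign[OF assms] by simp
  then show ?thesis
    by (subst (asm) prob_Collect_eq_1) auto
qed

lemma expectation_sign:
  assumes "1 \<le> i"
  shows "integrable M (\<epsilon> i)" "expectation (\<epsilon> i) = 0"
proof -
  note [measurable] = measurable_sign[OF assms]
  show "integrable M (\<epsilon> i)"
    by (rule integrable_const_bound[of _ 1]) (use AE_sign[OF assms] in auto)
  have "expectation (\<epsilon> i) = expectation (\<lambda>\<omega>.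
      indicator {\<omega> \<in> space M. \<epsilon> i \<omega> = 1} \<omega> - indicator {\<omega> \<in> space M. \<epsilon> i \<omega> = -1} \<omega>)"
    using AE_sign[OF assms] by (intro integral_cong_AE) (auto simp: indicator_def)
  also have "\<dots> = \<P>(\<omega> in M. \<epsilon> i \<omega> = 1) - \<P>(\<omega> in M. \<epsilon> i \<omega> = -1)"
    by (subst Bochner_Integration.integral_diff)
       (auto simp: Int_absorb2 intro!: integrable_real_indicator simp: less_top[symmetric])
  finally show "expectation (\<epsilon> i) = 0"
    using prob_sign[OF assms] by simp
qed

lemma expectation_sign_squared:
  assumes "1 \<le> i"
  shows "integrable M (\<lambda>\<omega>. (\<epsilon> i \<omega>)\<^sup>2)" "expectation (\<lambda>\<omega>. (\<epsilon> i \<omega>)\<^sup>2) = 1"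
proof -
  note [measurable] = measurable_sign[OF assms]
  show "integrable M (\<lambda>\<omega>. (\<epsilon> i \<omega>)\<^sup>2)"
    by (rule integrable_const_bound[of _ 1]) (use AE_sign[OF assms] in auto)
  have "expectation (\<lambda>\<omega>. (\<epsilon> i \<omega>)\<^sup>2) = expectation (\<lambda>_. 1)"
    using AE_sign[OF assms] by (intro integral_cong_AE) auto
  then show "expectation (\<lambda>\<omega>. (\<epsilon> i \<omega>)\<^sup>2) = 1"
    by (simp add: prob_space)
qed

definition signed_sum :: "(nat \<Rightarrow> real) \<Rightarrow> nat set \<Rightarrow> 'a \<Rightarrow> real" where
  "signed_sum b I \<omega> = (\<Sum>i\<in>I. \<epsilon> i \<omega> * b i)"

lemma measurable_signed_sum [measurable]:
  "I \<subseteq> {1..} \<Longrightarrow> signed_sum b I \<in> borel_measurable M"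
  unfolding signed_sum_def by (intro borel_measurable_sum borel_measurable_times measurable_sign) auto

lemma indep_signed_sums:
  assumes "I \<inter> J = {}" "I \<subseteq> {1..}" "J \<subseteq> {1..}"
  shows "indep_var borel (signed_sum b I) borel (signed_sum b J)"
proof -
  have "indep_var borel
      ((\<lambda>f. \<Sum>i\<in>I. f i * b i) \<circ> (\<lambda>\<omega>. restrict (\<lambda>i. \<epsilon> i \<omega>) I)) borel
      ((\<lambda>f. \<Sum>i\<in>J. f i * b i) \<circ> (\<lambda>\<omega>. restrict (\<lambda>i. \<epsilon> i \<omega>) J))"
    by (intro indep_var_compose[OF indep_var_restrict[OF indep_signs assms]]) measurable
  then show ?thesis
    by (simp add: o_def signed_sum_def[abs_def])
qed

text \<open>
  Each summand has mean zero and is independent of the sum of the others, so the cross term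
  vanishes when the square is expanded, and the second moments add up.
\<close>

lemma signed_sum_moments:
  assumes "finite I" "I \<subseteq> {1..}"
  shows "integrable M (signed_sum b I)"
    and "integrable M (\<lambda>\<omega>. (signed_sum b I \<omega>)\<^sup>2)"
    and "expectation (\<lambda>\<omega>. (signed_sum b I \<omega>)\<^sup>2) = (\<Sum>i\<in>I. (b i)\<^sup>2)"
proof -
  have "integrable M (signed_sum b I) \<and> integrable M (\<lambda>\<omega>. (signed_sum b I \<omega>)\<^sup>2) \<and>
      expectation (\<lambda>\<omega>. (signed_sum b I \<omega>)\<^sup>2) = (\<Sum>i\<in>I. (b i)\<^sup>2)"
    using assms
  proof (induction I rule: finite_induct)
    case empty
    then show ?case by (simp add: signed_sum_def[abs_def])
  next
    case (insert i I)
    then have i: "1 \<le> i" and I: "I \<subseteq> {1..}" and IH: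
      "integrable M (signed_sum b I)" "integrable M (\<lambda>\<omega>. (signed_sum b I \<omega>)\<^sup>2)"
      "expectation (\<lambda>\<omega>. (signed_sum b I \<omega>)\<^sup>2) = (\<Sum>i\<in>I. (b i)\<^sup>2)" by auto
    have single: "signed_sum b {i} = (\<lambda>\<omega>. \<epsilon> i \<omega> * b i)"
      by (simp add: signed_sum_def[abs_def])
    have split: "signed_sum b (insert i I) = (\<lambda>\<omega>. \<epsilon> i \<omega> * b i + signed_sum b I \<omega>)"
      using insert.hyps by (simp add: signed_sum_def[abs_def])
    have sq: "(\<lambda>\<omega>. (signed_sum b (insert i I) \<omega>)\<^sup>2) = (\<lambda>\<omega>. (\<epsilon> i \<omega>)\<^sup>2 * (b i)\<^sup>2 +
        2 * (\<epsilon> i \<omega> * b i * signed_sum b I \<omega>) + (signed_sum b I \<omega>)\<^sup>2)"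
      unfolding split by (auto simp: fun_eq_iff power2_eq_square algebra_simps)
    have "indep_var borel (\<lambda>\<omega>. \<epsilon> i \<omega> * b i) borel (signed_sum b I)"
      unfolding single[symmetric] using insert.hyps i I by (intro indep_signed_sums) auto
    note cross = indep_var_integrable[OF this _ IH(1)] indep_var_lebesgue_integral[OF this _ IH(1)]
    show ?case
      unfolding sq using cross IH expectation_sign[OF i] expectation_sign_squared[OF i] insert.hyps
      by (auto simp: split)
  qed
  then show "integrable M (signed_sum b I)" "integrable M (\<lambda>\<omega>. (signed_sum b I \<omega>)\<^sup>2)"
    "expectation (\<lambda>\<omega>. (signed_sum b I \<omega>)\<^sup>2) = (\<Sum>i\<in>I. (b i)\<^sup>2)" by auto
qed

lemma signed_sum_unit_interval:
  assumes "finite I" "I \<subseteq> {1..}" "(\<Sum>i\<in>I. (b i)\<^sup>2) \<le> s\<^sup>2" "1 \<le> s"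
  shows "\<exists>x. 3 / (20 * s) \<le> \<P>(\<omega> in M. x < signed_sum b I \<omega> \<and> signed_sum b I \<omega> \<le> x + 1)"
  using assms signed_sum_moments[OF assms(1,2)]
  by (intro ex_unit_interval_prob_ge) auto

lemma concentration_fun_power_steps_ge:
  assumes "0 \<le> \<alpha>" "1 \<le> n"
  shows "3 / 20 * real n powr (- (1 / 2 + \<alpha>))
    \<le> concentration_fun 1 M (\<lambda>\<omega>. \<Sum>i=1..n. \<epsilon> i \<omega> * real i powr \<alpha>)"
proof -
  define s where "s = real n powr (1 / 2 + \<alpha>)"
  have "(\<Sum>i=1..n. (real i powr \<alpha>)\<^sup>2) \<le> (\<Sum>i=1..n. (real n powr \<alpha>)\<^sup>2)"
    using assms by (intro sum_mono power_mono powr_mono2) auto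
  also have "\<dots> = s\<^sup>2"
    using assms by (simp add: s_def powr_add power_mult_distrib powr_half_sqrt)
  finally obtain x where "3 / (20 * s) \<le>
      \<P>(\<omega> in M. x < signed_sum (\<lambda>i. real i powr \<alpha>) {1..n} \<omega> \<and>
                signed_sum (\<lambda>i. real i powr \<alpha>) {1..n} \<omega> \<le> x + 1)"
    using signed_sum_unit_interval[of "{1..n}" "\<lambda>i. real i powr \<alpha>" s] assms
    by (auto simp: s_def ge_one_powr_ge_zero)
  also have "\<dots> \<le> concentration_fun 1 M (signed_sum (\<lambda>i. real i powr \<alpha>) {1..n})"
    by (rule concentration_fun_ge)
  finally show ?thesis
    using powr_minus_divide[of "real n" "1 / 2 + \<alpha>"] unfolding s_def signed_sum_def[abs_def] by simp
qed

section \<open>Atoms of block-constant signed sums\<close>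

text \<open>
  A half-open unit interval contains exactly one integer, so concentration of the integer-valued
  sum of signs is an atom, and an atom survives multiplication by the constant \<open>c\<close>,
  however large. The bound uses any \<open>N \<ge> card I\<close>, which also covers empty blocks and allows
  the end of a block to stand for its length.
\<close>

lemma constant_signed_sum_atom:
  assumes "finite I" "I \<subseteq> {1..}" "card I \<le> N" "1 \<le> N" and b: "\<And>i. i \<in> I \<Longrightarrow> b i = c"
  shows "\<exists>v. 3 / (20 * sqrt (real N)) \<le> \<P>(\<omega> in M. signed_sum b I \<omega> = v)"
proof -
  let ?T = "signed_sum (\<lambda>_. 1) I"
  have "(\<Sum>i\<in>I. 1\<^sup>2) \<le> (sqrt (real N))\<^sup>2" "1 \<le> sqrt (real N)"
    using assms by auto
  from signed_sum_unit_interval[OF assms(1,2) this]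
  obtain x where x: "3 / (20 * sqrt (real N)) \<le> \<P>(\<omega> in M. x < ?T \<omega> \<and> ?T \<omega> \<le> x + 1)"
    by auto
  note [measurable] = assms(2)
  have "AE \<omega> in M. \<forall>i\<in>I. \<epsilon> i \<omega> = 1 \<or> \<epsilon> i \<omega> = -1"
    using assms by (intro AE_finite_allI AE_sign) auto
  then have "AE \<omega> in M. ?T \<omega> \<in> \<int>"
    by eventually_elim (auto simp: signed_sum_def intro!: Ints_sum)
  then have "AE \<omega> in M. x < ?T \<omega> \<and> ?T \<omega> \<le> x + 1 \<longrightarrow>
      signed_sum b I \<omega> = of_int (\<lfloor>x\<rfloor> + 1) * c"
  proof eventually_elim
    case (elim \<omega>)
    then obtain z where z: "?T \<omega> = of_int z" by (auto elim: Ints_cases)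
    have "signed_sum b I \<omega> = ?T \<omega> * c"
      using b by (simp add: signed_sum_def sum_distrib_right)
    moreover have "z = \<lfloor>x\<rfloor> + 1" if "x < of_int z" "of_int z \<le> x + 1"
      using that by linarith
    ultimately show ?case using z by auto
  qed
  then have "\<P>(\<omega> in M. x < ?T \<omega> \<and> ?T \<omega> \<le> x + 1)
      \<le> \<P>(\<omega> in M. signed_sum b I \<omega> = of_int (\<lfloor>x\<rfloor> + 1) * c)"
    by (intro finite_measure_mono_AE) auto
  with x show ?thesis by (meson order_trans)
qed

lemma signed_sum_atom_Un:
  assumes "finite I" "finite J" "I \<inter> J = {}" "I \<subseteq> {1..}" "J \<subseteq> {1..}"
  shows "\<P>(\<omega> in M. signed_sum b I \<omega> = v) * \<P>(\<omega> in M. signed_sum b J \<omega> = w)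
    \<le> \<P>(\<omega> in M. signed_sum b (I \<union> J) \<omega> = v + w)"
proof -
  note [measurable] = assms(4,5)
  have "\<P>(\<omega> in M. signed_sum b I \<omega> = v) * \<P>(\<omega> in M. signed_sum b J \<omega> = w) =
      prob ((\<lambda>\<omega>. (signed_sum b I \<omega>, signed_sum b J \<omega>)) -` ({v} \<times> {w}) \<inter> space M)"
    by (subst indep_varD[OF indep_signed_sums[OF assms(3-5)]])
       (auto intro!: arg_cong2[where f = "(*)"] arg_cong[where f = prob])
  also have "\<dots> \<le> \<P>(\<omega> in M. signed_sum b (I \<union> J) \<omega> = v + w)"
  proof (intro finite_measure_mono)
    show "(\<lambda>\<omega>. (signed_sum b I \<omega>, signed_sum b J \<omega>)) -` ({v} \<times> {w}) \<inter> space M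
        \<subseteq> {\<omega> \<in> space M. signed_sum b (I \<union> J) \<omega> = v + w}"
      using assms by (auto simp: signed_sum_def sum.union_disjoint)
    have [measurable]: "signed_sum b (I \<union> J) \<in> borel_measurable M"
      using assms by (intro measurable_signed_sum) auto
    show "{\<omega> \<in> space M. signed_sum b (I \<union> J) \<omega> = v + w} \<in> events"
      by measurable
  qed
  finally show ?thesis .
qed

text \<open>
  The loss depends only on the block lengths, estimated here by the block ends \<open>t j\<close>;
  the step sizes \<open>c j\<close> are arbitrary.
\<close>

lemma block_constant_signed_sum_atom:
  fixes t :: "nat \<Rightarrow> nat"
  assumes "mono t" "1 \<le> t 0"
    and "\<And>i. 1 \<le> i \<Longrightarrow> i \<le> t 0 \<Longrightarrow> a i = c 0"
    and "\<And>i k. t k < i \<Longrightarrow> i \<le> t (Suc k) \<Longrightarrow> a i = c (Suc k)"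
  shows "\<exists>v. (\<Prod>j\<le>k. 3 / (20 * sqrt (real (t j)))) \<le> \<P>(\<omega> in M. signed_sum a {1..t k} \<omega> = v)"
proof (induction k)
  case 0
  show ?case
    using constant_signed_sum_atom[of "{1..t 0}" "t 0" a "c 0"] assms by auto
next
  case (Suc k)
  then obtain v where v: "(\<Prod>j\<le>k. 3 / (20 * sqrt (real (t j))))
      \<le> \<P>(\<omega> in M. signed_sum a {1..t k} \<omega> = v)" by blast
  have t: "t k \<le> t (Suc k)" "1 \<le> t (Suc k)"
    using monoD[OF \<open>mono t\<close>, of k "Suc k"] monoD[OF \<open>mono t\<close>, of 0 "Suc k"] \<open>1 \<le> t 0\<close> by auto
  obtain w where w: "3 / (20 * sqrt (real (t (Suc k))))
      \<le> \<P>(\<omega> in M. signed_sum a {t k<..t (Suc k)} \<omega> = w)"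
    using constant_signed_sum_atom[of "{t k<..t (Suc k)}" "t (Suc k)" a "c (Suc k)"] t assms(4)[of k]
    by (force simp: subset_eq)
  have "(\<Prod>j\<le>Suc k. 3 / (20 * sqrt (real (t j)))) \<le>
      \<P>(\<omega> in M. signed_sum a {1..t k} \<omega> = v) * \<P>(\<omega> in M. signed_sum a {t k<..t (Suc k)} \<omega> = w)"
    using mult_mono[OF v w] by simp
  also have "\<dots> \<le> \<P>(\<omega> in M. signed_sum a ({1..t k} \<union> {t k<..t (Suc k)}) \<omega> = v + w)"
    by (intro signed_sum_atom_Un) auto
  also have "{1..t k} \<union> {t k<..t (Suc k)} = {1..t (Suc k)}"
    using t by auto
  finally show ?case by blast
qed

end

section \<open>Doubly exponential blocks\<close>

definition block_end :: "real \<Rightarrow> nat \<Rightarrow> nat" where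
  "block_end q k = nat \<lfloor>exp (q ^ k)\<rfloor>"

text \<open>
  The block containing \<open>i\<close> ends at the first \<open>block_end q k\<close> that is at least \<open>i\<close>;
  the step is the smallest constant on that block compatible with the lower bound
  \<open>i powr \<alpha>\<close>.
\<close>

definition block_step :: "real \<Rightarrow> real \<Rightarrow> nat \<Rightarrow> real" where
  "block_step q \<alpha> i = real (block_end q (LEAST k. i \<le> block_end q k)) powr \<alpha>"

context
  fixes q :: real
  assumes q: "1 < q"
begin

lemma block_end_le: "real (block_end q k) \<le> exp (q ^ k)"
  unfolding block_end_def by simp

lemma block_end_gt: "exp (q ^ k) < real (block_end q k) + 1"
  using exp_gt_zero[of "q ^ k"] unfolding block_end_def by linarith

lemma block_end_ge_half: "exp (q ^ k) / 2 \<le> real (block_end q k)"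
proof -
  have "2 \<le> exp (1::real)" using exp_ge_add_one_self[of 1] by simp
  also have "\<dots> \<le> exp (q ^ k)" using q by (simp add: one_le_power)
  finally show ?thesis using block_end_gt[of k] by simp
qed

lemma block_end_pos: "1 \<le> block_end q k"
  using block_end_ge_half[of k] exp_gt_zero[of "q ^ k"] by (cases "block_end q k") auto

lemma mono_block_end: "mono (block_end q)"
  unfolding block_end_def using q
  by (intro monoI nat_mono floor_mono) (simp add: power_increasing)

lemma filterlim_block_end: "filterlim (block_end q) at_top sequentially"
proof -
  have "filterlim (\<lambda>k. exp (q ^ k) / 2) at_top sequentially"
    using q by real_asymp
  then have "filterlim (\<lambda>k. real (block_end q k)) at_top sequentially"
    by (rule filterlim_at_top_mono) (intro always_eventually allI block_end_ge_half)
  then show ?thesis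
    by (simp add: filterlim_sequentially_iff_filterlim_real)
qed

text \<open>
  The growth condition behind the upper bound on the steps. Rounding is harmless because it goes
  the right way on both sides: down at \<open>Suc k\<close>, and compensated by \<open>+ 1\<close> at \<open>k\<close>,
  where \<open>block_end q k + 1\<close> is the first index of the next block.
\<close>

lemma block_end_Suc_powr_le:
  assumes "0 \<le> \<alpha>"
  shows "real (block_end q (Suc k)) powr \<alpha> \<le> (real (block_end q k) + 1) powr (\<alpha> * q)"
proof -
  have "real (block_end q (Suc k)) powr \<alpha> \<le> exp (q ^ Suc k) powr \<alpha>"
    using assms block_end_le[of "Suc k"] by (intro powr_mono2) (auto simp del: power_Suc)
  also have "\<dots> = exp (q ^ k) powr (\<alpha> * q)"
    by (simp add: powr_def mult_ac)
  also have "\<dots> \<le> (real (block_end q k) + 1) powr (\<alpha> * q)"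
    using assms q less_imp_le[OF block_end_gt] by (intro powr_mono2) auto
  finally show ?thesis .
qed

lemma block_step_first: "i \<le> block_end q 0 \<Longrightarrow> block_step q \<alpha> i = real (block_end q 0) powr \<alpha>"
  unfolding block_step_def by (subst Least_eq_0) auto

lemma block_step_Suc:
  assumes "block_end q k < i" "i \<le> block_end q (Suc k)"
  shows "block_step q \<alpha> i = real (block_end q (Suc k)) powr \<alpha>"
proof -
  have "(LEAST k. i \<le> block_end q k) = Suc k"
  proof (rule Least_equality)
    fix j assume "i \<le> block_end q j"
    show "Suc k \<le> j"
    proof (rule ccontr)
      assume "\<not> Suc k \<le> j"
      then have "block_end q j \<le> block_end q k"
        using monoD[OF mono_block_end] by simp
      with assms \<open>i \<le> block_end q j\<close> show False by simp
    qed
  qed (use assms in auto)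
  then show ?thesis by (simp add: block_step_def)
qed

lemma block_step_bounds:
  assumes "0 \<le> \<alpha>" "block_end q 0 < i"
  shows "real i powr \<alpha> \<le> block_step q \<alpha> i" "block_step q \<alpha> i \<le> real i powr (\<alpha> * q)"
proof -
  have "\<exists>k. i \<le> block_end q k"
    using filterlim_block_end by (auto simp: filterlim_at_top eventually_sequentially)
  then have "\<exists>k. i \<le> block_end q (Suc k) \<and> block_end q k < i"
    using assms(2) exists_least_lemma[of "\<lambda>k. i \<le> block_end q k"] by (auto simp: not_le)
  then obtain k where k: "block_end q k < i" "i \<le> block_end q (Suc k)" by blast
  show "real i powr \<alpha> \<le> block_step q \<alpha> i"
    unfolding block_step_Suc[OF k] using k assms by (intro powr_mono2) auto
  have "block_step q \<alpha> i \<le> (real (block_end q k) + 1) powr (\<alpha> * q)"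
    unfolding block_step_Suc[OF k] by (rule block_end_Suc_powr_le) fact
  also have "\<dots> \<le> real i powr (\<alpha> * q)"
    using k assms q by (intro powr_mono2) auto
  finally show "block_step q \<alpha> i \<le> real i powr (\<alpha> * q)" .
qed

text \<open>
  The exponent \<open>\<theta> = q / (2 * (q - 1))\<close> is the fixed point of \<open>\<theta> = 1/2 + \<theta> / q\<close>. Hence
  the factor \<open>exp (- q ^ Suc k / 2)\<close> of a new block turns \<open>exp (- \<theta> * q ^ k)\<close>
  into exactly \<open>exp (- \<theta> * q ^ Suc k)\<close>, and no loss accumulates besides the constants
  \<open>3 / 20\<close>.
\<close>

lemma prod_block_end_ge:
  "(3 / 20) ^ Suc k * exp (- (q / (2 * (q - 1))) * q ^ k)
    \<le> (\<Prod>j\<le>k. 3 / (20 * sqrt (real (block_end q j))))"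
proof -
  have factor: "3 / 20 * exp (- (q ^ j / 2)) \<le> 3 / (20 * sqrt (real (block_end q j)))" for j
  proof -
    have "sqrt (real (block_end q j)) \<le> sqrt (exp (q ^ j))"
      using block_end_le by simp
    also have "\<dots> = exp (q ^ j / 2)"
      by (rule real_sqrt_unique) (simp_all add: exp_double[symmetric])
    finally show ?thesis
      using block_end_pos[of j] by (simp add: exp_minus field_simps)
  qed
  show ?thesis
  proof (induction k)
    case 0
    have "exp (- (q / (2 * (q - 1)))) \<le> exp (- (1 / 2))"
      using q by (simp add: field_simps)
    then have "3 / 20 * exp (- (q / (2 * (q - 1)))) \<le> 3 / 20 * exp (- (1 / 2))"
      by (intro mult_left_mono) auto
    also have "\<dots> \<le> 3 / (20 * sqrt (real (block_end q 0)))"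
      using factor[of 0] by (simp only: power_0)
    finally show ?case by (simp only: power_0 power_Suc atMost_0 prod.insert prod.empty
        finite.emptyI empty_iff not_False_eq_True mult_1_right)
  next
    case (Suc k)
    have "- (q / (2 * (q - 1))) * q ^ Suc k = - (q / (2 * (q - 1))) * q ^ k + - (q ^ Suc k / 2)"
      using q by (simp add: field_simps)
    then have "exp (- (q / (2 * (q - 1))) * q ^ Suc k) =
        exp (- (q / (2 * (q - 1))) * q ^ k) * exp (- (q ^ Suc k / 2))"
      by (simp only: exp_add)
    then have "(3 / 20) ^ Suc (Suc k) * exp (- (q / (2 * (q - 1))) * q ^ Suc k) =
        ((3 / 20) ^ Suc k * exp (- (q / (2 * (q - 1))) * q ^ k)) * (3 / 20 * exp (- (q ^ Suc k / 2)))"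
      by (simp only: power_Suc[of "3 / 20" "Suc k"] mult_ac)
    also have "\<dots> \<le> (\<Prod>j\<le>k. 3 / (20 * sqrt (real (block_end q j)))) *
        (3 / (20 * sqrt (real (block_end q (Suc k)))))"
      by (intro mult_mono Suc.IH factor prod_nonneg) auto
    finally show ?case by simp
  qed
qed

text \<open>
  The excess in the exponent that pays for the factor \<open>(3 / 20) ^ Suc k\<close> and for the rounding
  of \<open>exp (q ^ k)\<close> to \<open>block_end q k\<close>; the latter costs at most a factor \<open>2\<close>, whence
  the terms \<open>ln 2\<close>.
\<close>

definition block_error :: "nat \<Rightarrow> real" where
  "block_error k = (real (Suc k) * ln (20 / 3) + q / (2 * (q - 1)) * ln 2) / (q ^ k - ln 2)"

lemma block_error_tendsto_0: "block_error \<longlonglongrightarrow> 0"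
  unfolding block_error_def[abs_def] using q by real_asymp

lemma block_end_powr_le:
  "real (block_end q k) powr - (q / (2 * (q - 1)) + block_error k)
    \<le> (3 / 20) ^ Suc k * exp (- (q / (2 * (q - 1))) * q ^ k)"
proof -
  define \<theta> where "\<theta> = q / (2 * (q - 1))"
  have \<theta>: "0 \<le> \<theta>" using q by (simp add: \<theta>_def)
  have d: "0 < q ^ k - ln 2"
    using ln_2_less_1 one_le_power[of q k] q by linarith
  then have e: "0 \<le> block_error k"
    using \<theta> unfolding block_error_def \<theta>_def[symmetric] by (intro divide_nonneg_nonneg) auto
  have "q ^ k - ln 2 = ln (exp (q ^ k) / 2)"
    by (simp add: ln_div)
  also have "\<dots> \<le> ln (real (block_end q k))"
    using block_end_ge_half[of k] block_end_pos[of k] by (subst ln_le_cancel_iff) auto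
  finally have "(\<theta> + block_error k) * (q ^ k - ln 2) \<le> (\<theta> + block_error k) * ln (real (block_end q k))"
    using \<theta> e by (intro mult_left_mono) auto
  moreover have "(\<theta> + block_error k) * (q ^ k - ln 2) = \<theta> * q ^ k + real (Suc k) * ln (20 / 3)"
    using d unfolding block_error_def \<theta>_def[symmetric] by (simp add: field_simps)
  moreover have "real (Suc k) * ln (20 / 3) = - ln ((3 / 20) ^ Suc k)"
    by (simp add: ln_realpow ln_div del: power_Suc of_nat_Suc) (simp add: algebra_simps)
  ultimately have "exp (- (\<theta> + block_error k) * ln (real (block_end q k)))
      \<le> exp (ln ((3 / 20) ^ Suc k) + - \<theta> * q ^ k)"
    by (simp only: exp_le_cancel_iff minus_mult_left[symmetric])
  then show ?thesis
    using block_end_pos[of k] unfolding exp_add \<theta>_def[symmetric] by (simp add: powr_def)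
qed

end

lemma (in rademacher_space) concentration_fun_block_step_ge:
  assumes "1 < q"
  shows "real (block_end q k) powr - (q / (2 * (q - 1)) + block_error q k)
    \<le> concentration_fun 1 M (\<lambda>\<omega>. \<Sum>i=1..block_end q k. \<epsilon> i \<omega> * block_step q \<alpha> i)"
proof -
  let ?S = "signed_sum (block_step q \<alpha>) {1..block_end q k}"
  obtain v where v: "(\<Prod>j\<le>k. 3 / (20 * sqrt (real (block_end q j)))) \<le> \<P>(\<omega> in M. ?S \<omega> = v)"
    using block_constant_signed_sum_atom[OF mono_block_end[OF assms] block_end_pos[OF assms],
        of "block_step q \<alpha>" "\<lambda>k. real (block_end q k) powr \<alpha>" k]
      block_step_first[OF assms] block_step_Suc[OF assms] by blast
  note block_end_powr_le[OF assms] also note prod_block_end_ge[OF assms] also note v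
  also have "\<P>(\<omega> in M. ?S \<omega> = v) \<le> concentration_fun 1 M ?S"
    by (intro atom_le_concentration_fun measurable_signed_sum) auto
  finally show ?thesis
    by (simp add: signed_sum_def[abs_def])
qed

theorem proposition8:
  fixes M :: "'a measure" and \<epsilon> :: "nat \<Rightarrow> 'a \<Rightarrow> real" and \<alpha> :: real
  assumes "prob_space M"
    and "rademacher_sequence M \<epsilon>"
    and "\<alpha> > 0"
  shows "(\<lambda>n::nat. concentration_fun 1 M (\<lambda>\<omega>. \<Sum>i=1..n. \<epsilon> i \<omega> * real i powr \<alpha>))
           \<in> \<Omega>(\<lambda>n. real n powr (-(1/2 + \<alpha>)))
    \<and> (\<forall>\<delta>::real. \<delta> \<ge> 1/2 \<longrightarrow>
         (\<exists>(a :: nat \<Rightarrow> real) (t :: nat \<Rightarrow> nat).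
            (\<forall>n\<ge>1. a n \<ge> 0) \<and>
            filterlim t at_top sequentially \<and>
            (\<forall>\<^sub>F n in sequentially.
               real n powr \<alpha> \<le> a n \<and> a n \<le> real n powr (\<alpha> + \<delta>)) \<and>
            (\<exists>e :: nat \<Rightarrow> real. e \<in> o(\<lambda>_. 1) \<and>
               (\<forall>\<^sub>F k in sequentially.
                  concentration_fun 1 M (\<lambda>\<omega>. \<Sum>i=1..t k. \<epsilon> i \<omega> * a i)
                    \<ge> real (t k) powr (-(1/2 + \<alpha> / (2 * \<delta>) + e k))))))"
proof (intro conjI allI impI)
  interpret rademacher_space M \<epsilon>
    using assms by (simp add: rademacher_space_def rademacher_space_axioms_def)
  show "(\<lambda>n::nat. concentration_fun 1 M (\<lambda>\<omega>. \<Sum>i=1..n. \<epsilon> i \<omega> * real i powr \<alpha>))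
      \<in> \<Omega>(\<lambda>n. real n powr (-(1/2 + \<alpha>)))"
  proof (rule landau_omega.bigI[of "3 / 20"])
    show "\<forall>\<^sub>F n in sequentially. 3 / 20 * norm (real n powr (-(1/2 + \<alpha>)))
        \<le> norm (concentration_fun 1 M (\<lambda>\<omega>. \<Sum>i=1..n. \<epsilon> i \<omega> * real i powr \<alpha>))"
      using eventually_ge_at_top[of 1]
    proof eventually_elim
      case (elim n)
      then show ?case
        using concentration_fun_power_steps_ge[of \<alpha> n] \<open>\<alpha> > 0\<close> by simp
    qed
  qed simp
  fix \<delta> :: real assume \<delta>: "\<delta> \<ge> 1/2"
  (* The fastest growth of the blocks for which the steps stay below n powr (\<alpha> + \<delta>). *)
  define q where "q = 1 + \<delta> / \<alpha>"
  have q: "1 < q" "\<alpha> * q = \<alpha> + \<delta>"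
    using \<delta> \<open>\<alpha> > 0\<close> by (simp_all add: q_def field_simps)
  have \<theta>: "q / (2 * (q - 1)) = 1/2 + \<alpha> / (2 * \<delta>)"
    using \<delta> \<open>\<alpha> > 0\<close> by (simp add: q_def field_simps)
  have bounds: "\<forall>\<^sub>F n in sequentially.
      real n powr \<alpha> \<le> block_step q \<alpha> n \<and> block_step q \<alpha> n \<le> real n powr (\<alpha> + \<delta>)"
    using eventually_gt_at_top[of "block_end q 0"]
    by eventually_elim (use block_step_bounds[OF q(1), of \<alpha>] q(2) \<open>\<alpha> > 0\<close> in auto)
  have "block_error q \<in> o(\<lambda>_. 1)"
    using block_error_tendsto_0[OF q(1)] by (intro smalloI_tendsto) auto
  moreover have "\<forall>\<^sub>F k in sequentially.
      concentration_fun 1 M (\<lambda>\<omega>. \<Sum>i=1..block_end q k. \<epsilon> i \<omega> * block_step q \<alpha> i)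
        \<ge> real (block_end q k) powr (-(1/2 + \<alpha> / (2 * \<delta>) + block_error q k))"
    using concentration_fun_block_step_ge[OF q(1), unfolded \<theta>] by (intro always_eventually allI)
  moreover have "\<forall>n\<ge>1. block_step q \<alpha> n \<ge> 0"
    by (simp add: block_step_def)
  ultimately show "\<exists>(a :: nat \<Rightarrow> real) (t :: nat \<Rightarrow> nat).
            (\<forall>n\<ge>1. a n \<ge> 0) \<and>
            filterlim t at_top sequentially \<and>
            (\<forall>\<^sub>F n in sequentially.
               real n powr \<alpha> \<le> a n \<and> a n \<le> real n powr (\<alpha> + \<delta>)) \<and>
            (\<exists>e :: nat \<Rightarrow> real. e \<in> o(\<lambda>_. 1) \<and>
               (\<forall>\<^sub>F k in sequentially.
                  concentration_fun 1 M (\<lambda>\<omega>. \<Sum>i=1..t k. \<epsilon> i \<omega> * a i)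
                    \<ge> real (t k) powr (-(1/2 + \<alpha> / (2 * \<delta>) + e k))))"
    using bounds filterlim_block_end[OF q(1)] by blast
qed

end
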